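(* Let $I\subseteq\mathbb{R}$ be an interval, let $a,b,c,f_4\in C^\infty(I)$ be real-valued, and let $C_{12}\in\mathbb{R}$. Assume $C_{12}+2\int^{x}a(\psi)e^{-\int^{\psi}\left[\frac{f_4(\phi)}{2}+b(\phi)\right]d\phi}\,d\psi\neq0$ on $I$. Suppose that for all $x\in I$ $$c(x)=\frac{f_4(x)\,e^{-\int^{x}\left[\frac{f_4(\phi)}{2}+b(\phi)\right]d\phi}}{C_{12}+2\int^{x}a(\psi)\,e^{-\int^{\psi}\left[\frac{f_4(\phi)}{2}+b(\phi)\right]d\phi}\,d\psi}.$$ Then the general solution of the Riccati equation $\frac{dy}{dx}=a(x)+b(x)y+c(x)y^2$ is $$y(x)=\frac{e^{\int^{x}[f_4(\phi)+b(\phi)]\,d\phi}}{C_{13}-\int^{x}\left\{\frac{f_4(\psi)\,e^{-\int^{\psi}\left[\frac{f_4(\phi)}{2}+b(\phi)\right]d\phi}}{C_{12}+2\int^{\psi}a(\omega)\,e^{-\int^{\omega}\left[\frac{f_4(\phi)}{2}+b(\phi)\right]d\phi}\,d\omega}\right\}e^{\int^{\psi}[f_4(\phi)+b(\phi)]\,d\phi}\,d\psi}+\frac12\left\{C_{12}+2\int^{x}a(\omega)\,e^{-\int^{\omega}\left[\frac{f_4(\phi)}{2}+b(\phi)\right]d\phi}\,d\omega\right\}e^{\int^{x}\left[\frac{f_4(\phi)}{2}+b(\phi)\right]d\phi},$$ where $C_{13}$ is an arbitrary constant of integration.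
   Context: $\int^{x}g(\phi)\,d\phi$ denotes a fixed antiderivative of $g$ on $I$, the same one wherever the same integrand occurs. "The general solution is $y(x)=\frac{G(x)}{C-H(x)}+y_p(x)$ with $C$ an arbitrary constant" means: for every real $C$, this function satisfies the equation on every subinterval of $I$ on which $C-H$ does not vanish; and conversely every differentiable solution on a nondegenerate subinterval of $I$ is either of this form for some real $C$ (with nonvanishing denominator there) or equal to $y_p$ (the limiting case $C=\infty$). *)

theory Defs
  imports "HOL-Analysis.Analysis"
begin

text \<open>Derivatives are taken within the interval, hence one-sided at an endpoint that belongs to it.
  The sequence \<open>D\<close> lists the successive derivatives of \<open>f\<close>; its members
  are unconstrained outside \<open>I\<close>.\<close>

definition smooth_on :: "real set \<Rightarrow> (real \<Rightarrow> real) \<Rightarrow> bool" where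
  "smooth_on I f \<longleftrightarrow>
    (\<exists>D :: nat \<Rightarrow> real \<Rightarrow> real.
      (\<forall>x\<in>I. D 0 x = f x) \<and>
      (\<forall>n. \<forall>x\<in>I. (D n has_real_derivative D (Suc n) x) (at x within I)))"

definition antiderivative_on :: "real set \<Rightarrow> (real \<Rightarrow> real) \<Rightarrow> (real \<Rightarrow> real) \<Rightarrow> bool" where
  "antiderivative_on I g G \<longleftrightarrow> (\<forall>x\<in>I. (G has_real_derivative g x) (at x within I))"

definition riccati_solution_on ::
  "(real \<Rightarrow> real) \<Rightarrow> (real \<Rightarrow> real) \<Rightarrow> (real \<Rightarrow> real) \<Rightarrow> real set \<Rightarrow> (real \<Rightarrow> real) \<Rightarrow> bool" where
  "riccati_solution_on a b c J y \<longleftrightarrow>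
    (\<forall>x\<in>J. (y has_real_derivative a x + b x * y x + c x * (y x)\<^sup>2) (at x within J))"

text \<open>The second alternative of the converse, \<open>y = y\<^sub>p\<close>, is the limiting case \<open>C = \<infinity>\<close>.\<close>

definition riccati_general_solution ::
  "(real \<Rightarrow> real) \<Rightarrow> (real \<Rightarrow> real) \<Rightarrow> (real \<Rightarrow> real) \<Rightarrow> real set \<Rightarrow>
   (real \<Rightarrow> real) \<Rightarrow> (real \<Rightarrow> real) \<Rightarrow> (real \<Rightarrow> real) \<Rightarrow> bool" where
  "riccati_general_solution a b c I G H y\<^sub>p \<longleftrightarrow>
    (\<forall>(C::real) J. is_interval J \<longrightarrow> J \<subseteq> I \<longrightarrow> (\<forall>x\<in>J. C - H x \<noteq> 0) \<longrightarrow>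
       riccati_solution_on a b c J (\<lambda>x. G x / (C - H x) + y\<^sub>p x)) \<and>
    (\<forall>J y. is_interval J \<longrightarrow> J \<subseteq> I \<longrightarrow> (\<exists>u\<in>J. \<exists>v\<in>J. u < v) \<longrightarrow>
       riccati_solution_on a b c J y \<longrightarrow>
       (\<exists>C::real. \<forall>x\<in>J. C - H x \<noteq> 0 \<and> y x = G x / (C - H x) + y\<^sub>p x) \<or>
       (\<forall>x\<in>J. y x = y\<^sub>p x))"

end

theory Submission
  imports Defs
begin

text \<open>
  The hypothesis on \<open>c\<close> makes \<open>y\<^sub>p = (C\<^sub>1\<^sub>2 + 2 A) e\<^sup>E / 2\<close> a particular solution: variation of
  constants gives \<open>y\<^sub>p' = a + (f\<^sub>4 / 2 + b) y\<^sub>p\<close>, and the hypothesis says exactly that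
  \<open>c y\<^sub>p = f\<^sub>4 / 2\<close>. Everything else is the classical reduction of a Riccati equation with a known
  solution. The difference \<open>w = y - y\<^sub>p\<close> satisfies the Bernoulli equation
  \<open>w' = q w + c w\<^sup>2\<close> with \<open>q = b + 2 c y\<^sub>p\<close>, here \<open>q = f\<^sub>4 + b\<close>. If \<open>G' = q G\<close> with
  \<open>G\<close> nowhere zero and \<open>H' = c G\<close>, then \<open>G / w + H\<close> has derivative zero wherever \<open>w \<noteq> 0\<close>,
  so \<open>w = G / (C - H)\<close> on every interval free of zeros of \<open>w\<close>
  (\<open>bernoulli_first_integral\<close>).

  It remains to see that a solution \<open>w\<close> with one zero vanishes identically. Instead of
  appealing to a uniqueness theorem for differential equations, one uses the first integral again
  (\<open>bernoulli_zero_imp_trivial\<close>): if \<open>w p = 0\<close> and \<open>w\<close> has no zero on some open interval ending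
  at \<open>p\<close>, then \<open>G = w (C - H)\<close> holds on that interval, hence at \<open>p\<close> by continuity, which
  contradicts \<open>G p \<noteq> 0\<close>.
\<close>

lemma bernoulli_first_integral:
  fixes w q c G H :: "real \<Rightarrow> real"
  assumes "convex S"
    and w: "\<And>x. x \<in> S \<Longrightarrow> (w has_real_derivative q x * w x + c x * (w x)\<^sup>2) (at x within S)"
    and G: "\<And>x. x \<in> S \<Longrightarrow> (G has_real_derivative q x * G x) (at x within S)"
    and H: "\<And>x. x \<in> S \<Longrightarrow> (H has_real_derivative c x * G x) (at x within S)"
    and nz: "\<And>x. x \<in> S \<Longrightarrow> w x \<noteq> 0"
  shows "\<exists>C. \<forall>x\<in>S. G x = w x * (C - H x)"
proof -
  have "((\<lambda>x. G x / w x + H x) has_real_derivative 0) (at x within S)" if "x \<in> S" for x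
    by (rule DERIV_cong[OF DERIV_add[OF DERIV_divide[OF G[OF that] w[OF that] nz[OF that]] H[OF that]]])
      (use nz[OF that] in \<open>simp add: divide_simps, simp add: power2_eq_square algebra_simps\<close>)
  then obtain C where C: "\<forall>x\<in>S. G x / w x + H x = C"
    using has_field_derivative_zero_constant[OF \<open>convex S\<close>, of "\<lambda>x. G x / w x + H x"] by auto
  have "G x = w x * (C - H x)" if "x \<in> S" for x
    unfolding C[rule_format, OF that, symmetric] using nz[OF that] by simp
  then show ?thesis
    by blast
qed

text \<open>
  Suppose \<open>w x \<noteq> 0\<close>. Among the zeros of \<open>w\<close> between \<open>z\<close> and \<open>x\<close> let \<open>p\<close> be the closest to
  \<open>x\<close>. The first integral is available on the open segment from \<open>p\<close> to \<open>x\<close>, and multiplied out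
  as \<open>w (C - H) = G\<close> it extends to \<open>p\<close>, forcing \<open>G p = 0\<close>.
\<close>

lemma bernoulli_zero_imp_trivial:
  fixes w q c G H :: "real \<Rightarrow> real"
  assumes "convex S"
    and w: "\<And>x. x \<in> S \<Longrightarrow> (w has_real_derivative q x * w x + c x * (w x)\<^sup>2) (at x within S)"
    and G: "\<And>x. x \<in> S \<Longrightarrow> (G has_real_derivative q x * G x) (at x within S)"
    and H: "\<And>x. x \<in> S \<Longrightarrow> (H has_real_derivative c x * G x) (at x within S)"
    and G_nz: "\<And>x. x \<in> S \<Longrightarrow> G x \<noteq> 0"
    and z: "z \<in> S" "w z = 0" and x: "x \<in> S"
  shows "w x = 0"
proof (rule ccontr)
  assume x_nz: "w x \<noteq> 0"
  have cont: "continuous_on S w" "continuous_on S G" "continuous_on S H"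
    by (rule DERIV_continuous_on, fact w G H)+
  have zx: "closed_segment z x \<subseteq> S"
    using \<open>convex S\<close> z x by (simp add: closed_segment_subset)
  have "closed {t \<in> closed_segment z x. w t = 0}"
    by (intro continuous_closed_preimage_constant continuous_on_subset[OF cont(1) zx]) simp
  moreover have "{t \<in> closed_segment z x. w t = 0} \<noteq> {}"
    using z by auto
  ultimately obtain p where "p \<in> {t \<in> closed_segment z x. w t = 0}"
    and "\<And>t. t \<in> {t \<in> closed_segment z x. w t = 0} \<Longrightarrow> dist x p \<le> dist x t"
    by (rule distance_attains_inf[where a = x]) blast
  then have p: "p \<in> closed_segment z x" "w p = 0"
    and closest: "\<And>t. t \<in> closed_segment z x \<Longrightarrow> w t = 0 \<Longrightarrow> dist x p \<le> dist x t"
    by simp_all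
  have px: "closed_segment p x \<subseteq> closed_segment z x"
    using p by (simp add: subset_closed_segment)
  have "p \<noteq> x"
    using p x_nz by blast
  let ?T = "open_segment p x"
  have T: "?T \<subseteq> S"
    using px zx segment_open_subset_closed by blast
  have clT: "closure ?T = closed_segment p x"
    using \<open>p \<noteq> x\<close> by simp
  have T_nz: "w t \<noteq> 0" if "t \<in> ?T" for t
  proof
    assume "w t = 0"
    moreover have "t \<in> closed_segment z x"
      using that px segment_open_subset_closed by blast
    moreover have "dist x t < dist x p"
      using dist_in_open_segment[OF that] by (simp add: dist_commute)
    ultimately show False
      using closest by force
  qed
  have "\<exists>C. \<forall>t\<in>?T. G t = w t * (C - H t)"
  proof (rule bernoulli_first_integral[where q = q and c = c])
    fix t assume t: "t \<in> ?T"
    then have "t \<in> S"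
      using T by blast
    show "(w has_real_derivative q t * w t + c t * (w t)\<^sup>2) (at t within ?T)"
      by (rule DERIV_subset[OF w[OF \<open>t \<in> S\<close>] T])
    show "(G has_real_derivative q t * G t) (at t within ?T)"
      by (rule DERIV_subset[OF G[OF \<open>t \<in> S\<close>] T])
    show "(H has_real_derivative c t * G t) (at t within ?T)"
      by (rule DERIV_subset[OF H[OF \<open>t \<in> S\<close>] T])
    show "w t \<noteq> 0"
      by (rule T_nz[OF t])
  qed simp
  then obtain C where C: "\<forall>t\<in>?T. G t = w t * (C - H t)"
    by blast
  have "continuous_on (closure ?T) (\<lambda>t. w t * (C - H t) - G t)"
    unfolding clT
    by (intro continuous_intros cont[THEN continuous_on_subset] subset_trans[OF px zx])
  then have "w p * (C - H p) - G p = 0"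
    by (rule continuous_constant_on_closure) (use C \<open>p \<noteq> x\<close> in auto)
  then show False
    using p G_nz zx by auto
qed

lemma antiderivative_on_subset:
  assumes "antiderivative_on I g G" and "J \<subseteq> I"
  shows "antiderivative_on J g G"
  unfolding antiderivative_on_def
proof
  fix x assume "x \<in> J"
  then have "(G has_real_derivative g x) (at x within I)"
    using assms by (auto simp: antiderivative_on_def)
  then show "(G has_real_derivative g x) (at x within J)"
    by (rule DERIV_subset) (rule \<open>J \<subseteq> I\<close>)
qed

lemma riccati_solution_on_subset:
  assumes "riccati_solution_on a b c I y" and "J \<subseteq> I"
  shows "riccati_solution_on a b c J y"
  using antiderivative_on_subset[of I "\<lambda>x. a x + b x * y x + c x * (y x)\<^sup>2" y J] assms
  by (simp add: antiderivative_on_def riccati_solution_on_def)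

lemma riccati_difference:
  assumes y: "(y has_real_derivative a x + b x * y x + c x * (y x)\<^sup>2) (at x within S)"
    and yp: "(y\<^sub>p has_real_derivative a x + b x * y\<^sub>p x + c x * (y\<^sub>p x)\<^sup>2) (at x within S)"
  shows "((\<lambda>x. y x - y\<^sub>p x) has_real_derivative
    (b x + 2 * c x * y\<^sub>p x) * (y x - y\<^sub>p x) + c x * (y x - y\<^sub>p x)\<^sup>2) (at x within S)"
  by (rule DERIV_cong[OF DERIV_diff[OF y yp]]) (simp add: power2_eq_square algebra_simps)

text \<open>
  For the converse there are only two cases, because a zero of \<open>w = y - y\<^sub>p\<close> forces \<open>w\<close> to vanish
  identically: \<open>w = 0\<close> is the limiting case \<open>C = \<infinity>\<close>, and a nowhere vanishing \<open>w\<close> has the first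
  integral \<open>C\<close>. In the latter case \<open>C - H\<close> cannot vanish because \<open>G = w (C - H)\<close> does not.
\<close>

lemma riccati_general_solution_from_particular:
  assumes yp: "riccati_solution_on a b c I y\<^sub>p"
    and G: "antiderivative_on I (\<lambda>x. (b x + 2 * c x * y\<^sub>p x) * G x) G"
    and H: "antiderivative_on I (\<lambda>x. c x * G x) H"
    and G_nz: "\<And>x. x \<in> I \<Longrightarrow> G x \<noteq> 0"
  shows "riccati_general_solution a b c I G H y\<^sub>p"
  unfolding riccati_general_solution_def
proof (intro conjI allI impI)
  fix C :: real and J
  assume J: "is_interval J" "J \<subseteq> I" and nz: "\<forall>x\<in>J. C - H x \<noteq> 0"
  show "riccati_solution_on a b c J (\<lambda>x. G x / (C - H x) + y\<^sub>p x)"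
    unfolding riccati_solution_on_def
  proof
    fix x assume x: "x \<in> J"
    have yp': "(y\<^sub>p has_real_derivative a x + b x * y\<^sub>p x + c x * (y\<^sub>p x)\<^sup>2) (at x within J)"
      using riccati_solution_on_subset[OF yp J(2)] x by (simp add: riccati_solution_on_def)
    have G': "(G has_real_derivative (b x + 2 * c x * y\<^sub>p x) * G x) (at x within J)"
      using antiderivative_on_subset[OF G J(2)] x by (simp add: antiderivative_on_def)
    have H': "(H has_real_derivative c x * G x) (at x within J)"
      using antiderivative_on_subset[OF H J(2)] x by (simp add: antiderivative_on_def)
    have d: "C - H x \<noteq> 0"
      using nz x by blast
    have D: "((\<lambda>x. G x / (C - H x) + y\<^sub>p x) has_real_derivative
        ((b x + 2 * c x * y\<^sub>p x) * G x * (C - H x) - G x * (0 - c x * G x))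
          / ((C - H x) * (C - H x))
        + (a x + b x * y\<^sub>p x + c x * (y\<^sub>p x)\<^sup>2)) (at x within J)"
      by (intro DERIV_add DERIV_divide DERIV_diff DERIV_const G' H' yp' d)
    show "((\<lambda>x. G x / (C - H x) + y\<^sub>p x) has_real_derivative
        a x + b x * (G x / (C - H x) + y\<^sub>p x) + c x * (G x / (C - H x) + y\<^sub>p x)\<^sup>2) (at x within J)"
    proof (rule DERIV_cong[OF D])
      define d where "d = C - H x"
      have "d \<noteq> 0"
        using \<open>C - H x \<noteq> 0\<close> by (simp add: d_def)
      then show "((b x + 2 * c x * y\<^sub>p x) * G x * (C - H x) - G x * (0 - c x * G x))
          / ((C - H x) * (C - H x))
        + (a x + b x * y\<^sub>p x + c x * (y\<^sub>p x)\<^sup>2)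
        = a x + b x * (G x / (C - H x) + y\<^sub>p x) + c x * (G x / (C - H x) + y\<^sub>p x)\<^sup>2"
        unfolding d_def[symmetric]
        by (simp add: field_simps power2_eq_square)
    qed
  qed
next
  fix J y
  assume J: "is_interval J" "J \<subseteq> I" and y: "riccati_solution_on a b c J y"
  define w where "w x = y x - y\<^sub>p x" for x
  define q where "q x = b x + 2 * c x * y\<^sub>p x" for x
  have "convex J"
    using J(1) by (simp add: is_interval_convex_1)
  have w': "(w has_real_derivative q x * w x + c x * (w x)\<^sup>2) (at x within J)" if "x \<in> J" for x
    unfolding w_def q_def
    by (rule riccati_difference[where a = a])
      (use y riccati_solution_on_subset[OF yp J(2)] that in \<open>simp_all add: riccati_solution_on_def\<close>)
  have G': "(G has_real_derivative q x * G x) (at x within J)" if "x \<in> J" for x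
    using antiderivative_on_subset[OF G J(2)] that by (simp add: q_def antiderivative_on_def)
  have H': "(H has_real_derivative c x * G x) (at x within J)" if "x \<in> J" for x
    using antiderivative_on_subset[OF H J(2)] that by (simp add: antiderivative_on_def)
  have G_nz': "G x \<noteq> 0" if "x \<in> J" for x
    using G_nz that J by blast
  show "(\<exists>C. \<forall>x\<in>J. C - H x \<noteq> 0 \<and> y x = G x / (C - H x) + y\<^sub>p x) \<or> (\<forall>x\<in>J. y x = y\<^sub>p x)"
  proof (cases "\<exists>z\<in>J. w z = 0")
    case True
    then have "\<forall>x\<in>J. w x = 0"
      using bernoulli_zero_imp_trivial[OF \<open>convex J\<close> w' G' H' G_nz'] by blast
    then show ?thesis
      by (simp add: w_def)
  next
    case False
    then obtain C where C: "\<And>x. x \<in> J \<Longrightarrow> G x = w x * (C - H x)"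
      using bernoulli_first_integral[OF \<open>convex J\<close> w' G' H'] by blast
    have "C - H x \<noteq> 0 \<and> y x = G x / (C - H x) + y\<^sub>p x" if "x \<in> J" for x
    proof
      show "C - H x \<noteq> 0"
        using C G_nz' that by force
      then show "y x = G x / (C - H x) + y\<^sub>p x"
        by (simp add: C[OF that] w_def)
    qed
    then show ?thesis
      by blast
  qed
qed

theorem theorem9:
  fixes I :: "real set"
    and a b c f\<^sub>4 :: "real \<Rightarrow> real"
    and C\<^sub>1\<^sub>2 :: real
    and E A Q H :: "real \<Rightarrow> real"
  assumes "is_interval I"
    and "smooth_on I a" and "smooth_on I b" and "smooth_on I c" and "smooth_on I f\<^sub>4"
    and "antiderivative_on I (\<lambda>x. f\<^sub>4 x / 2 + b x) E"
    and "antiderivative_on I (\<lambda>x. a x * exp (- E x)) A"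
    and "antiderivative_on I (\<lambda>x. f\<^sub>4 x + b x) Q"
    and "antiderivative_on I
           (\<lambda>x. f\<^sub>4 x * exp (- E x) / (C\<^sub>1\<^sub>2 + 2 * A x) * exp (Q x)) H"
    and "\<forall>x\<in>I. C\<^sub>1\<^sub>2 + 2 * A x \<noteq> 0"
    and "\<forall>x\<in>I. c x = f\<^sub>4 x * exp (- E x) / (C\<^sub>1\<^sub>2 + 2 * A x)"
  shows "riccati_general_solution a b c I
           (\<lambda>x. exp (Q x)) H (\<lambda>x. 1 / 2 * (C\<^sub>1\<^sub>2 + 2 * A x) * exp (E x))"
proof -
  define y\<^sub>p where "y\<^sub>p x = 1 / 2 * (C\<^sub>1\<^sub>2 + 2 * A x) * exp (E x)" for x
  \<comment> \<open>Hence \<open>c y\<^sub>p\<^sup>2 = f\<^sub>4 y\<^sub>p / 2\<close>, so that the Riccati equation for \<open>y\<^sub>p\<close> becomes linear, and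
    \<open>b + 2 c y\<^sub>p = f\<^sub>4 + b\<close>, the logarithmic derivative of \<open>e\<^sup>Q\<close>.\<close>
  have c_yp: "c x * y\<^sub>p x = f\<^sub>4 x / 2" if "x \<in> I" for x
    using assms(10,11) that by (simp add: y\<^sub>p_def exp_minus)
  have "riccati_solution_on a b c I y\<^sub>p"
    unfolding riccati_solution_on_def
  proof
    fix x assume x: "x \<in> I"
    have E': "(E has_real_derivative f\<^sub>4 x / 2 + b x) (at x within I)"
      and A': "(A has_real_derivative a x * exp (- E x)) (at x within I)"
      using assms(6,7) x by (auto simp: antiderivative_on_def)
    have "(y\<^sub>p has_real_derivative a x + (f\<^sub>4 x / 2 + b x) * y\<^sub>p x) (at x within I)"
      unfolding y\<^sub>p_def
      by (auto intro!: derivative_eq_intros E' A' simp: exp_minus field_simps)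
    also have "a x + (f\<^sub>4 x / 2 + b x) * y\<^sub>p x = a x + b x * y\<^sub>p x + c x * (y\<^sub>p x)\<^sup>2"
    proof -
      have "c x * (y\<^sub>p x)\<^sup>2 = f\<^sub>4 x / 2 * y\<^sub>p x"
        unfolding c_yp[OF x, symmetric] by (simp add: power2_eq_square)
      then show ?thesis
        by (simp add: algebra_simps)
    qed
    finally show "(y\<^sub>p has_real_derivative a x + b x * y\<^sub>p x + c x * (y\<^sub>p x)\<^sup>2) (at x within I)" .
  qed
  moreover have "antiderivative_on I (\<lambda>x. (b x + 2 * c x * y\<^sub>p x) * exp (Q x)) (\<lambda>x. exp (Q x))"
    unfolding antiderivative_on_def
  proof
    fix x assume x: "x \<in> I"
    have "(Q has_real_derivative f\<^sub>4 x + b x) (at x within I)"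
      using assms(8) x by (auto simp: antiderivative_on_def)
    moreover have "b x + 2 * c x * y\<^sub>p x = f\<^sub>4 x + b x"
      using c_yp[OF x] by (simp add: mult.assoc)
    ultimately show "((\<lambda>x. exp (Q x)) has_real_derivative (b x + 2 * c x * y\<^sub>p x) * exp (Q x))
        (at x within I)"
      by (auto intro!: derivative_eq_intros)
  qed
  moreover have "antiderivative_on I (\<lambda>x. c x * exp (Q x)) H"
    using assms(9,11) by (simp add: antiderivative_on_def)
  ultimately have "riccati_general_solution a b c I (\<lambda>x. exp (Q x)) H y\<^sub>p"
    by (rule riccati_general_solution_from_particular) simp
  then show ?thesis
    by (simp only: y\<^sub>p_def[abs_def])
qed

end
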